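(* Every outer-$1$-planar graph is proper conflict-free $6$-choosable.
   Context: All graphs are simple and finite. A graph is outer-$1$-planar if it admits a drawing in the plane with all vertices on the outer face and with at most one crossing per edge. A proper conflict-free coloring of a graph $G$ is a proper vertex coloring $\phi$ such that for every non-isolated vertex $v$ some color appears exactly once on the open neighborhood $N(v)$. $G$ is proper conflict-free $k$-choosable if for every list assignment $L$ of $G$ with $|L(v)| = k$ for all $v\in V(G)$, there is a proper conflict-free coloring $\phi$ of $G$ with $\phi(v)\in L(v)$ for all $v\in V(G)$. *)

theory Defs
  imports "HOL-Analysis.Analysis"
begin

section \<open>Finite simple graphs\<close>

definition simple_graph :: "'a set \<Rightarrow> 'a set set \<Rightarrow> bool" where
  "simple_graph V E \<longleftrightarrow> finite V \<and> (\<forall>e\<in>E. e \<subseteq> V \<and> card e = 2)"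

definition nbhd :: "'a set set \<Rightarrow> 'a \<Rightarrow> 'a set" where
  "nbhd E v = {u. {v, u} \<in> E}"

section \<open>Drawings in the plane\<close>

definition drawing ::
  "'a set \<Rightarrow> 'a set set \<Rightarrow> ('a \<Rightarrow> complex) \<Rightarrow> ('a set \<Rightarrow> real \<Rightarrow> complex) \<Rightarrow> bool" where
  "drawing V E pos \<gamma> \<longleftrightarrow>
     inj_on pos V \<and>
     (\<forall>e\<in>E. arc (\<gamma> e) \<and>
            {pathstart (\<gamma> e), pathfinish (\<gamma> e)} = pos ` e \<and>
            path_image (\<gamma> e) \<inter> pos ` V = pos ` e)"

definition drawing_image ::
  "'a set \<Rightarrow> 'a set set \<Rightarrow> ('a \<Rightarrow> complex) \<Rightarrow> ('a set \<Rightarrow> real \<Rightarrow> complex) \<Rightarrow> complex set" where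
  "drawing_image V E pos \<gamma> = pos ` V \<union> (\<Union>e\<in>E. path_image (\<gamma> e))"

text \<open>
  The crossings on an edge \<open>e\<close> are recorded as pairs (other edge, point). Every common point of two
  distinct edges other than a common end vertex counts, so touchings and intersections of adjacent
  edges are counted too. If three edges pass through one point, each of them has two crossings
  there; thus a bound of one crossing per edge incorporates the usual convention that no three
  edges cross in a common point.
\<close>
definition crossings ::
  "'a set \<Rightarrow> 'a set set \<Rightarrow> ('a \<Rightarrow> complex) \<Rightarrow> ('a set \<Rightarrow> real \<Rightarrow> complex) \<Rightarrow> 'a set
     \<Rightarrow> ('a set \<times> complex) set" where
  "crossings V E pos \<gamma> e =
     {(f, p). f \<in> E \<and> f \<noteq> e \<and> p \<in> path_image (\<gamma> e) \<inter> path_image (\<gamma> f) - pos ` V}"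

text \<open>
  The drawing is a compact subset of the plane, so \<^const>\<open>outside\<close> yields the unique unbounded
  component of its complement, i.e. the outer face.
\<close>
definition outer_1_planar :: "'a set \<Rightarrow> 'a set set \<Rightarrow> bool" where
  "outer_1_planar V E \<longleftrightarrow>
     (\<exists>pos \<gamma>. drawing V E pos \<gamma> \<and>
        (\<forall>v\<in>V. pos v \<in> frontier (outside (drawing_image V E pos \<gamma>))) \<and>
        (\<forall>e\<in>E. finite (crossings V E pos \<gamma> e) \<and> card (crossings V E pos \<gamma> e) \<le> 1))"

section \<open>Proper conflict-free colorings\<close>

definition proper_coloring :: "'a set set \<Rightarrow> ('a \<Rightarrow> 'c) \<Rightarrow> bool" where
  "proper_coloring E \<phi> \<longleftrightarrow> (\<forall>u v. {u, v} \<in> E \<longrightarrow> \<phi> u \<noteq> \<phi> v)"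

definition proper_conflict_free_coloring ::
  "'a set \<Rightarrow> 'a set set \<Rightarrow> ('a \<Rightarrow> 'c) \<Rightarrow> bool" where
  "proper_conflict_free_coloring V E \<phi> \<longleftrightarrow>
     proper_coloring E \<phi> \<and>
     (\<forall>v\<in>V. nbhd E v \<noteq> {} \<longrightarrow> (\<exists>c. \<exists>!u. u \<in> nbhd E v \<and> \<phi> u = c))"

text \<open>The first argument only fixes the type from which the colors in the lists are taken.\<close>
definition proper_conflict_free_choosable ::
  "'c itself \<Rightarrow> 'a set \<Rightarrow> 'a set set \<Rightarrow> nat \<Rightarrow> bool" where
  "proper_conflict_free_choosable (_ :: 'c itself) V E k \<longleftrightarrow>
     (\<forall>L :: 'a \<Rightarrow> 'c set. (\<forall>v\<in>V. finite (L v) \<and> card (L v) = k) \<longrightarrow>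
        (\<exists>\<phi>. proper_conflict_free_coloring V E \<phi> \<and> (\<forall>v\<in>V. \<phi> v \<in> L v)))"

end

theory Submission
  imports Defs
begin

text \<open>
  Joining the vertices to a horizontal line far below the drawing by disjoint arcs ("legs") in the
  outer face orders them linearly; two edges whose ends alternate in this order must cross, so every
  edge alternates with at most one other edge.

  An inclusion-minimal interval of this order that no edge leaves from its interior has one or two
  interior vertices. They are attached only to the two ends \<open>p\<close>, \<open>q\<close> of the interval; delete them
  and insert the edge \<open>pq\<close>, which alternates with nothing. By induction color the rest with
  different colors on \<open>p\<close> and \<open>q\<close>. Each deleted vertex only has to avoid the colors of \<open>p\<close> and \<open>q\<close>
  and one color that is unique around each of them, which leaves two colors: enough to make \<open>p\<close>,
  \<open>q\<close> and the deleted vertices pairwise differently colored, so that every color around a deleted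
  vertex is unique.
\<close>

section \<open>Coloring graphs drawn with vertices in convex position\<close>

definition alternate :: "('a \<Rightarrow> real) \<Rightarrow> 'a set \<Rightarrow> 'a set \<Rightarrow> bool" where
  "alternate pr e f \<longleftrightarrow>
     (\<exists>a b c d. pr a < pr c \<and> pr c < pr b \<and> pr b < pr d \<and>
        (e = {a, b} \<and> f = {c, d} \<or> e = {c, d} \<and> f = {a, b}))"

text \<open>This models vertices on a circle, cut open into a line by \<open>pr\<close>, with edges
  as chords: chords cross exactly when their ends alternate. One crossing per edge becomes
  uniqueness of the alternating partner.\<close>

definition circular_1_planar :: "('a \<Rightarrow> real) \<Rightarrow> 'a set \<Rightarrow> 'a set set \<Rightarrow> bool" where
  "circular_1_planar pr V E \<longleftrightarrow> inj_on pr V \<and>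
     (\<forall>e\<in>E. \<forall>f\<in>E. \<forall>g\<in>E. alternate pr e f \<longrightarrow> alternate pr e g \<longrightarrow> f = g)"

definition between :: "('a \<Rightarrow> real) \<Rightarrow> 'a set \<Rightarrow> 'a \<Rightarrow> 'a \<Rightarrow> 'a set" where
  "between pr V p q = {v \<in> V. pr p < pr v \<and> pr v < pr q}"

text \<open>Only edges at interior vertices are confined; edges at \<open>p\<close> or
  \<open>q\<close> may leave. Thus \<open>p\<close> and \<open>q\<close> separate the interior from
  all other vertices.\<close>

definition closed_interval :: "('a \<Rightarrow> real) \<Rightarrow> 'a set \<Rightarrow> 'a set set \<Rightarrow> 'a \<Rightarrow> 'a \<Rightarrow> bool" where
  "closed_interval pr V E p q \<longleftrightarrow> p \<in> V \<and> q \<in> V \<and> pr p < pr q \<and>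
     (\<forall>x r. x \<in> between pr V p q \<longrightarrow> {x, r} \<in> E \<longrightarrow> pr p \<le> pr r \<and> pr r \<le> pr q)"

lemma circular_1_planarD:
  assumes "circular_1_planar pr V E" "e \<in> E" "f \<in> E" "g \<in> E" "alternate pr e f" "alternate pr e g"
  shows "f = g"
  using assms unfolding circular_1_planar_def by blast

lemma alternateI:
  assumes "pr a < pr c" "pr c < pr b" "pr b < pr d"
  shows "alternate pr {a, b} {c, d}" "alternate pr {c, d} {a, b}"
  using assms unfolding alternate_def by blast+

lemma simple_graph_edgeD:
  assumes "simple_graph V E" "{x, y} \<in> E"
  shows "x \<in> V" "y \<in> V" "x \<noteq> y"
proof -
  have *: "{x, y} \<subseteq> V" "card {x, y} = 2" using assms unfolding simple_graph_def by auto
  then show "x \<in> V" "y \<in> V" by auto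
  show "x \<noteq> y" using *(2) by auto
qed

section \<open>Minimal closed intervals\<close>

text \<open>The edges \<open>ac\<close> and \<open>bd\<close> are each other's only alternating
  partners, whereas any edge leaving one of the four intervals from its interior would alternate
  with one of them.\<close>

lemma crossing_closed_intervals:
  assumes G: "simple_graph V E" and C: "circular_1_planar pr V E"
    and lt: "pr a < pr b" "pr b < pr c" "pr c < pr d"
    and ac: "{a, c} \<in> E" and bd: "{b, d} \<in> E"
  shows "closed_interval pr V E a b" "closed_interval pr V E b c" "closed_interval pr V E c d"
    "closed_interval pr V E a d"
proof -
  have alt: "alternate pr {a, c} {b, d}" "alternate pr {b, d} {a, c}"
    using alternateI lt by metis+
  have V: "a \<in> V" "b \<in> V" "c \<in> V" "d \<in> V"
    using simple_graph_edgeD[OF G] ac bd by blast+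
  \<comment> \<open>The edge \<open>bd\<close> itself is excluded by the last premise; only
    \<open>b\<close> can play the role of \<open>x\<close>, as \<open>d\<close> lies beyond
    \<open>c\<close>.\<close>
  have noac: False if "{x, r} \<in> E" "pr a < pr x" "pr x < pr c" "pr r < pr a \<or> pr c < pr r" "x \<noteq> b \<or> r \<noteq> d" for x r
  proof -
    have "alternate pr {a, c} {x, r}"
      using that(2-4) alternateI(1)[of pr a x c r] alternateI(2)[of pr r a x c]
      by (auto simp: insert_commute)
    then have "{x, r} = {b, d}"
      using circular_1_planarD[OF C ac that(1) bd] alt by blast
    then show False using that lt by (auto simp: doubleton_eq_iff)
  qed
  have nobd: False if "{x, r} \<in> E" "pr b < pr x" "pr x < pr d" "pr r < pr b \<or> pr d < pr r" "x \<noteq> c \<or> r \<noteq> a" for x r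
  proof -
    have "alternate pr {b, d} {x, r}"
      using that(2-4) alternateI(1)[of pr b x d r] alternateI(2)[of pr r b x d]
      by (auto simp: insert_commute)
    then have "{x, r} = {a, c}"
      using circular_1_planarD[OF C bd that(1) ac] alt by blast
    then show False using that lt by (auto simp: doubleton_eq_iff)
  qed
  have sw: "{r, x} \<in> E" if "{x, r} \<in> E" for x r using that by (simp add: insert_commute)
  show "closed_interval pr V E a b"
    unfolding closed_interval_def between_def
  proof (intro conjI allI impI V lt)
    fix x r assume x: "x \<in> {v \<in> V. pr a < pr v \<and> pr v < pr b}" and xr: "{x, r} \<in> E"
    show "pr a \<le> pr r" using noac[OF xr] x lt by force
    show "pr r \<le> pr b"
    proof (rule ccontr)
      assume r: "\<not> pr r \<le> pr b"
      have "r \<in> V" using simple_graph_edgeD[OF G xr] by simp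
      \<comment> \<open>An edge passing over \<open>b\<close> from its left alternates with
        \<open>bd\<close> if it ends before \<open>d\<close>, and with \<open>ac\<close>
        otherwise.\<close>
      show False
      proof (cases "pr r < pr d")
        case True then show False using nobd[OF sw[OF xr]] x r by force
      next
        case False then show False using noac[OF xr] x r lt by force
      qed
    qed
  qed
  show "closed_interval pr V E b c"
    unfolding closed_interval_def between_def
  proof (intro conjI allI impI V lt)
    fix x r assume x: "x \<in> {v \<in> V. pr b < pr v \<and> pr v < pr c}" and xr: "{x, r} \<in> E"
    show "pr b \<le> pr r" using nobd[OF xr] x lt by force
    show "pr r \<le> pr c" using noac[OF xr] x lt by force
  qed
  show "closed_interval pr V E c d"
    unfolding closed_interval_def between_def
  proof (intro conjI allI impI V lt)
    fix x r assume x: "x \<in> {v \<in> V. pr c < pr v \<and> pr v < pr d}" and xr: "{x, r} \<in> E"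
    show "pr r \<le> pr d" using nobd[OF xr] x lt by force
    show "pr c \<le> pr r"
    proof (rule ccontr)
      assume r: "\<not> pr c \<le> pr r"
      show False
      proof (cases "pr a < pr r")
        case True then show False using noac[OF sw[OF xr]] x r by force
      next
        case False then show False using nobd[OF xr] x r lt by force
      qed
    qed
  qed
  show "closed_interval pr V E a d"
    unfolding closed_interval_def between_def
  proof (intro conjI allI impI V)
    show "pr a < pr d" using lt by simp
    fix x r assume x: "x \<in> {v \<in> V. pr a < pr v \<and> pr v < pr d}" and xr: "{x, r} \<in> E"
    have "x \<in> V" "r \<in> V" using simple_graph_edgeD[OF G xr] by auto
    show "pr r \<le> pr d"
    proof (cases "pr x < pr c")
      case True then show ?thesis using noac[OF xr] x lt by force
    next
      case False then show ?thesis using nobd[OF xr] x lt by force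
    qed
    show "pr a \<le> pr r"
    proof (cases "pr x < pr c")
      case True then show ?thesis using noac[OF xr] x lt by force
    next
      case False then show ?thesis using nobd[OF xr] x lt by force
    qed
  qed
qed

text \<open>Take a closed interval with the smallest nonempty interior. If two edges cross within
  it, the intervals between their ends leave room for only two interior vertices. Otherwise every
  edge within it, except possibly \<open>pq\<close>, spans an empty interval; then the piece up to
  the second interior vertex is closed too, against minimality.\<close>

lemma exists_small_closed_interval:
  assumes G: "simple_graph V E" and C: "circular_1_planar pr V E" and V3: "3 \<le> card V"
  obtains p q where "closed_interval pr V E p q"
    "1 \<le> card (between pr V p q)" "card (between pr V p q) \<le> 2"
proof -
  have fin: "finite V" using G by (simp add: simple_graph_def)
  have finb: "finite (between pr V p q)" for p q using fin by (simp add: between_def)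
  have inj: "inj_on pr V" using C by (simp add: circular_1_planar_def)
  define P where "P = (\<lambda>(p, q). closed_interval pr V E p q \<and> between pr V p q \<noteq> {})"
  \<comment> \<open>The leftmost and the rightmost vertex qualify: a third vertex lies strictly
    between them.\<close>
  have "\<exists>pq. P pq"
  proof -
    have ne: "V \<noteq> {}" using V3 by auto
    have finp: "finite (pr ` V)" "pr ` V \<noteq> {}" using fin ne by auto
    obtain p where p: "p \<in> V" "\<And>v. v \<in> V \<Longrightarrow> pr p \<le> pr v"
      using Min_in[OF finp] Min_le[OF finp(1)] by fastforce
    obtain q where q: "q \<in> V" "\<And>v. v \<in> V \<Longrightarrow> pr v \<le> pr q"
      using Max_in[OF finp] Max_ge[OF finp(1)] by fastforce
    have "\<not> V \<subseteq> {p, q}"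
    proof
      assume "V \<subseteq> {p, q}"
      then have "card V \<le> card {p, q}" by (intro card_mono) auto
      also have "\<dots> \<le> 2" by (simp add: card_insert_if)
      finally show False using V3 by simp
    qed
    then obtain x where x: "x \<in> V" "x \<noteq> p" "x \<noteq> q" by blast
    then have "pr p < pr x" "pr x < pr q"
      using p q inj unfolding inj_on_def by (metis order_le_less)+
    moreover have "pr p \<le> pr r \<and> pr r \<le> pr q" if "{y, r} \<in> E" for y r
      using p q simple_graph_edgeD[OF G that] by blast
    ultimately have "P (p, q)"
      using p(1) q(1) x(1) by (auto simp: P_def closed_interval_def between_def)
    then show ?thesis ..
  qed
  then obtain pq where "P pq" and minpq: "\<And>z. P z \<Longrightarrow> card (between pr V (fst pq) (snd pq)) \<le> card (between pr V (fst z) (snd z))"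
    using ex_has_least_nat[of P _ "\<lambda>z. card (between pr V (fst z) (snd z))"] by metis
  obtain p q where [simp]: "pq = (p, q)" by fastforce
  have cl: "closed_interval pr V E p q" and ne: "between pr V p q \<noteq> {}"
    using \<open>P pq\<close> by (auto simp: P_def)
  \<comment> \<open>Least cardinality yields inclusion: a nested closed interval with nonempty
    interior already has the full interior.\<close>
  have minl: "between pr V p q \<subseteq> between pr V i j"
    if "closed_interval pr V E i j" "between pr V i j \<noteq> {}" "pr p \<le> pr i" "pr j \<le> pr q" for i j
  proof -
    have "between pr V i j \<subseteq> between pr V p q"
      using that by (auto simp: between_def)
    moreover have "card (between pr V p q) \<le> card (between pr V i j)"
      using minpq[of "(i, j)"] that by (auto simp: P_def)
    ultimately show ?thesis using finb card_seteq by blast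
  qed
  have memb: "x \<in> between pr V p q" if "x \<in> V" "pr p < pr x" "pr x < pr q" for x
    using that by (simp add: between_def)
  have pqV: "p \<in> V" "q \<in> V" "pr p < pr q" using cl by (auto simp: closed_interval_def)
  have eqp: "x = y" if "x \<in> V" "y \<in> V" "pr x = pr y" for x y
    using inj that unfolding inj_on_def by blast
  have stay: "pr p \<le> pr r \<and> pr r \<le> pr q" if "{x, r} \<in> E" "pr p < pr x" "pr x < pr q" for x r
    using cl that simple_graph_edgeD[OF G that(1)] memb unfolding closed_interval_def by blast
  \<comment> \<open>Each of the three inner intervals misses \<open>b\<close> or \<open>c\<close>,
    so by \<open>minl\<close> it is empty; the outer one contains the whole interior. Hence only
    \<open>b\<close> and \<open>c\<close> remain.\<close>
  have cross: "card (between pr V p q) \<le> 2"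
    if lt: "pr a < pr b" "pr b < pr c" "pr c < pr d" and "{a, c} \<in> E" "{b, d} \<in> E"
      and ends: "pr p \<le> pr a" "pr d \<le> pr q" for a b c d
  proof -
    note ci = crossing_closed_intervals[OF G C that(1-5)]
    have bc: "b \<in> between pr V p q" "c \<in> between pr V p q"
      using that simple_graph_edgeD[OF G that(4)] simple_graph_edgeD[OF G that(5)] by (auto simp: between_def)
    have notin: "b \<notin> between pr V a b" "b \<notin> between pr V b c" "c \<notin> between pr V c d"
      by (simp_all add: between_def)
    have "between pr V a b = {}" using minl[OF ci(1) _ ends(1)] bc notin lt ends by force
    moreover have "between pr V b c = {}" using minl[OF ci(2)] bc notin lt ends by force
    moreover have "between pr V c d = {}" using minl[OF ci(3) _ _ ends(2)] bc notin lt ends by force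
    ultimately have gap: "\<not> (pr a < pr v \<and> pr v < pr b)" "\<not> (pr b < pr v \<and> pr v < pr c)"
      "\<not> (pr c < pr v \<and> pr v < pr d)" if "v \<in> V" for v
      using that unfolding between_def by blast+
    have "between pr V a d \<subseteq> {b, c}"
    proof
      fix v assume "v \<in> between pr V a d"
      then have v: "v \<in> V" "pr a < pr v" "pr v < pr d" by (simp_all add: between_def)
      then have "pr v = pr b \<or> pr v = pr c" using gap[OF v(1)] by linarith
      then show "v \<in> {b, c}" using eqp v(1) bc by (auto simp: between_def)
    qed
    moreover have "b \<in> between pr V a d" using lt bc by (auto simp: between_def)
    then have "between pr V p q \<subseteq> between pr V a d" using minl[OF ci(4)] ends by blast
    ultimately have "card (between pr V p q) \<le> card {b, c}" by (intro card_mono) auto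
    then show ?thesis by (simp add: card_insert_if split: if_splits)
  qed
  have "card (between pr V p q) \<le> 2"
  proof (rule ccontr)
    assume big: "\<not> ?thesis"
    \<comment> \<open>The interval spanned by \<open>ij\<close> misses the interior vertex
      \<open>i\<close> or \<open>j\<close>, so if nonempty it is not closed. Some edge then leaves
      it and alternates with \<open>ij\<close>, which \<open>cross\<close> forbids.\<close>
    have short: "between pr V i j = {}" if ij: "{i, j} \<in> E" "pr p \<le> pr i" "pr j \<le> pr q" "pr i < pr j"
      and nopq: "pr p < pr i \<or> pr j < pr q" for i j
    proof (rule ccontr)
      assume ne: "between pr V i j \<noteq> {}"
      have ijV: "i \<in> V" "j \<in> V" using simple_graph_edgeD[OF G ij(1)] by auto
      have "\<not> closed_interval pr V E i j"
      proof
        assume "closed_interval pr V E i j"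
        then have "between pr V p q \<subseteq> between pr V i j" using minl ne ij by blast
        moreover have "i \<in> between pr V p q \<or> j \<in> between pr V p q"
          using nopq ij ijV by (auto simp: between_def)
        ultimately show False by (auto simp: between_def)
      qed
      then obtain k l where k: "k \<in> between pr V i j" and kl: "{k, l} \<in> E" and l: "pr l < pr i \<or> pr j < pr l"
        using ijV ij(4) unfolding closed_interval_def by (auto simp: not_le)
      have k': "pr i < pr k" "pr k < pr j" using k by (auto simp: between_def)
      have lpq: "pr p \<le> pr l" "pr l \<le> pr q" using stay[OF kl] k' ij by auto
      show False
        using l
      proof
        assume "pr l < pr i"
        moreover have "{l, k} \<in> E" using kl by (simp add: insert_commute)
        ultimately show False using cross[of l i k j] k' lpq ij big by blast
      next
        assume "pr j < pr l"
        then show False using cross[of i k j l] k' lpq ij kl big by blast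
      qed
    qed
    have fb: "finite (pr ` between pr V p q)" using finb by simp
    \<comment> \<open>\<open>x\<close> and \<open>y\<close> become the first two interior vertices.
      An edge from \<open>x\<close> beyond \<open>y\<close> would span \<open>y\<close>, against
      \<open>short\<close>, so the interval from \<open>p\<close> to \<open>y\<close> is
      closed.\<close>
    obtain x where x: "x \<in> between pr V p q" "\<And>v. v \<in> between pr V p q \<Longrightarrow> pr x \<le> pr v"
      using ex_min_if_finite[of "pr ` between pr V p q"] fb ne by (force simp: not_less)
    have "between pr V p q - {x} \<noteq> {}"
    proof
      assume "between pr V p q - {x} = {}"
      then have "card (between pr V p q) \<le> card {x}" by (intro card_mono) auto
      then show False using big by simp
    qed
    then obtain y where y: "y \<in> between pr V p q - {x}" "\<And>v. v \<in> between pr V p q - {x} \<Longrightarrow> pr y \<le> pr v"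
      using ex_min_if_finite[of "pr ` (between pr V p q - {x})"] finb by (force simp: not_less)
    have xy: "pr x < pr y" using x y eqp[of x y] by (force simp: between_def)
    have only: "between pr V p y = {x}"
      using x y xy by (force simp: between_def)
    have xb: "x \<in> V" "pr p < pr x" "pr x < pr q" using x(1) by (auto simp: between_def)
    have yb: "y \<in> V" "pr p < pr y" "pr y < pr q" using y(1) by (auto simp: between_def)
    have "closed_interval pr V E p y"
      unfolding closed_interval_def only
    proof (intro conjI allI impI)
      show "p \<in> V" "y \<in> V" "pr p < pr y" using pqV yb by auto
      fix x' r assume "x' \<in> {x}" and "{x', r} \<in> E"
      then have xr: "{x, r} \<in> E" by simp
      show "pr p \<le> pr r" using stay[OF xr] xb by blast
      show "pr r \<le> pr y"
      proof (rule ccontr)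
        assume "\<not> pr r \<le> pr y"
        then have "y \<in> between pr V x r" using xy yb by (auto simp: between_def)
        moreover have "between pr V x r = {}"
          using short[OF xr] stay[OF xr] xb xy \<open>\<not> pr r \<le> pr y\<close> by auto
        ultimately show False by simp
      qed
    qed
    then have "between pr V p q \<subseteq> {x}" using minl[of p y] only yb by auto
    then show False using y by auto
  qed
  moreover have "1 \<le> card (between pr V p q)"
    using ne finb by (simp add: Suc_leI card_gt_0_iff)
  ultimately show thesis using that cl by blast
qed

section \<open>Extending a coloring to one or two new vertices\<close>

lemma exists_injective_choice:
  assumes S: "1 \<le> card S" "card S \<le> 2" and L: "\<And>v. v \<in> S \<Longrightarrow> finite (L v) \<and> 2 \<le> card (L v)"
  obtains g where "inj_on g S" "\<And>v. v \<in> S \<Longrightarrow> g v \<in> L v"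
proof -
  consider "card S = 1" | "card S = 2" using S by linarith
  then show thesis
  proof cases
    case 1
    then obtain x where [simp]: "S = {x}" by (auto simp: card_1_singleton_iff)
    have "L x \<noteq> {}" using L[of x] by auto
    then obtain c where "c \<in> L x" by blast
    then show thesis using that[of "\<lambda>_. c"] by auto
  next
    case 2
    then obtain x y where S2: "S = {x, y}" "x \<noteq> y" by (auto simp: card_2_iff)
    have "L x \<noteq> {}" using L[of x] S2 by auto
    then obtain c where c: "c \<in> L x" by blast
    have "\<not> L y \<subseteq> {c}"
    proof
      assume "L y \<subseteq> {c}"
      then have "card (L y) \<le> 1" using card_mono[of "{c}" "L y"] by simp
      then show False using L[of y] S2 by auto
    qed
    then obtain d where "d \<in> L y" "d \<noteq> c" by blast
    then show thesis using c S2
      by (intro that[of "\<lambda>v. if v = x then c else d"]) (auto simp: inj_on_def split: if_splits)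
  qed
qed

lemma proper_coloring_subset: "proper_coloring F \<phi> \<Longrightarrow> E \<subseteq> F \<Longrightarrow> proper_coloring E \<phi>"
  unfolding proper_coloring_def by (meson subsetD)

lemma nbhd_iff: "u \<in> nbhd E v \<longleftrightarrow> {v, u} \<in> E"
  by (simp add: nbhd_def)

text \<open>Forbidding on \<open>S\<close> the colors of \<open>W\<close> and one unique color
  around each vertex of \<open>W\<close> costs at most four of six colors. The remaining two allow
  an injective choice, and the old unique colors survive. \<open>W\<close> may be empty, which
  serves the base case of the induction.\<close>

lemma extend_conflict_free:
  fixes L :: "'a \<Rightarrow> 'c set"
  assumes S: "1 \<le> card S" "card S \<le> 2" and W: "finite W" "card W \<le> 2" "S \<inter> W = {}"
    and L: "\<And>v. v \<in> S \<Longrightarrow> finite (L v) \<and> card (L v) = 6"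
    and att: "\<And>x r. x \<in> S \<Longrightarrow> {x, r} \<in> E \<Longrightarrow> r \<in> S \<union> W"
    and injW: "inj_on \<phi> W"
    and cf: "\<And>v. v \<in> V - S \<Longrightarrow> nbhd {e \<in> E. e \<inter> S = {}} v \<noteq> {} \<Longrightarrow>
               \<exists>c. \<exists>!u. u \<in> nbhd {e \<in> E. e \<inter> S = {}} v \<and> \<phi> u = c"
    and WV: "W \<subseteq> V"
  shows "\<exists>\<psi>. (\<forall>v. v \<notin> S \<longrightarrow> \<psi> v = \<phi> v) \<and> (\<forall>v\<in>S. \<psi> v \<in> L v) \<and> inj_on \<psi> (S \<union> W) \<and>
    (\<forall>v\<in>V. nbhd E v \<noteq> {} \<longrightarrow> (\<exists>c. \<exists>!u. u \<in> nbhd E v \<and> \<psi> u = c))"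
proof -
  let ?E' = "{e \<in> E. e \<inter> S = {}}"
  \<comment> \<open>For a vertex without old neighbors this is an arbitrary color; forbidding it too
    keeps the bound of four.\<close>
  define uq where "uq v = (SOME c. \<exists>!u. u \<in> nbhd ?E' v \<and> \<phi> u = c)" for v
  have uq: "\<exists>!u. u \<in> nbhd ?E' v \<and> \<phi> u = uq v" if "v \<in> V - S" "nbhd ?E' v \<noteq> {}" for v
    unfolding uq_def by (rule someI_ex[OF cf[OF that]])
  define F where "F = \<phi> ` W \<union> uq ` W"
  have F: "finite F" "card F \<le> 4"
  proof -
    show "finite F" using W by (simp add: F_def)
    have "card F \<le> card (\<phi> ` W) + card (uq ` W)" unfolding F_def by (rule card_Un_le)
    also have "\<dots> \<le> 2 + 2"
      using card_image_le[OF W(1), of \<phi>] card_image_le[OF W(1), of uq] W(2) by linarith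
    finally show "card F \<le> 4" by simp
  qed
  have "finite (L v - F) \<and> 2 \<le> card (L v - F)" if "v \<in> S" for v
    using L[OF that] diff_card_le_card_Diff[OF F(1), of "L v"] F(2) by auto
  then obtain g where g: "inj_on g S" "\<And>v. v \<in> S \<Longrightarrow> g v \<in> L v - F"
    using exists_injective_choice[OF S, of "\<lambda>v. L v - F"] by blast
  define \<psi> where "\<psi> v = (if v \<in> S then g v else \<phi> v)" for v
  have inj: "inj_on \<psi> (S \<union> W)"
  proof -
    have "g v \<noteq> \<phi> w" if "v \<in> S" "w \<in> W" for v w using g(2)[OF that(1)] that(2) by (auto simp: F_def)
    then show ?thesis using g(1) injW W(3)
      unfolding inj_on_def \<psi>_def by (metis UnE disjoint_iff)
  qed
  show ?thesis
  proof (intro exI[of _ \<psi>] conjI ballI allI impI)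
    show "\<psi> v = \<phi> v" if "v \<notin> S" for v using that by (simp add: \<psi>_def)
    show "\<psi> v \<in> L v" if "v \<in> S" for v using that g by (simp add: \<psi>_def)
    show "inj_on \<psi> (S \<union> W)" by (rule inj)
    fix v assume v: "v \<in> V" and ne: "nbhd E v \<noteq> {}"
    have easy: "\<exists>c. \<exists>!u. u \<in> nbhd E v \<and> \<psi> u = c" if "nbhd E v \<subseteq> S \<union> W"
    proof -
      obtain u where u: "u \<in> nbhd E v" using ne by blast
      then have "\<exists>!u'. u' \<in> nbhd E v \<and> \<psi> u' = \<psi> u"
        using inj that unfolding inj_on_def by blast
      then show ?thesis by blast
    qed
    have old: "u \<in> nbhd ?E' v \<longleftrightarrow> u \<in> nbhd E v \<and> u \<notin> S" if "v \<notin> S" for u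
      using that by (auto simp: nbhd_iff)
    \<comment> \<open>A new vertex, or an old one with only new neighbors, sees pairwise different
      colors. Any other vertex keeps the color that was unique among its old neighbors.\<close>
    show "\<exists>c. \<exists>!u. u \<in> nbhd E v \<and> \<psi> u = c"
    proof (cases "v \<in> S \<or> nbhd E v \<subseteq> S")
      case True
      then have "nbhd E v \<subseteq> S \<union> W" using att True unfolding nbhd_def by blast
      then show ?thesis by (rule easy)
    next
      case False
      then have vS: "v \<notin> S" and ne': "nbhd ?E' v \<noteq> {}" using old by auto
      have "\<exists>!u. u \<in> nbhd ?E' v \<and> \<phi> u = uq v" using uq v vS ne' by blast
      then obtain u where u: "u \<in> nbhd ?E' v" "\<phi> u = uq v"
        "\<And>u'. u' \<in> nbhd ?E' v \<Longrightarrow> \<phi> u' = uq v \<Longrightarrow> u' = u" by blast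
      \<comment> \<open>Only vertices of \<open>W\<close> gain neighbors, and for these
        \<open>uq v\<close> was forbidden on \<open>S\<close>.\<close>
      have new: "g u' \<noteq> uq v" if "u' \<in> nbhd E v" "u' \<in> S" for u'
      proof -
        have "v \<in> W" using att[of u' v] that vS by (auto simp: nbhd_iff insert_commute)
        then show ?thesis using g(2)[OF that(2)] by (auto simp: F_def)
      qed
      have "\<exists>!u'. u' \<in> nbhd E v \<and> \<psi> u' = uq v"
      proof (rule ex1I[of _ u])
        have "u \<in> nbhd E v" "u \<notin> S" using u(1) old[OF vS] by blast+
        then show "u \<in> nbhd E v \<and> \<psi> u = uq v" using u(2) by (simp add: \<psi>_def)
        fix u' assume u': "u' \<in> nbhd E v \<and> \<psi> u' = uq v"
        then have "u' \<notin> S" using new[of u'] by (auto simp: \<psi>_def)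
        then have "u' \<in> nbhd ?E' v" "\<phi> u' = uq v" using u' old[OF vS] by (simp_all add: \<psi>_def)
        then show "u' = u" by (rule u(3))
      qed
      then show ?thesis by blast
    qed
  qed
qed

section \<open>Induction on the number of vertices\<close>

text \<open>Inserting \<open>pq\<close> changes the neighborhoods of \<open>p\<close> and
  \<open>q\<close>, and a color unique in the larger neighborhood may be absent from the original
  one. Hence two edge sets: \<open>H\<close> collects the inserted edges and governs properness,
  while conflict-freeness refers to \<open>G\<close>, into which nothing is inserted.\<close>

lemma circular_1_planar_conflict_free:
  fixes L :: "'a \<Rightarrow> 'c set"
  assumes "simple_graph V H" "circular_1_planar pr V H" "G \<subseteq> H"
    and "\<And>v. v \<in> V \<Longrightarrow> finite (L v) \<and> card (L v) = 6"
  shows "\<exists>\<phi>. proper_coloring H \<phi> \<and> proper_conflict_free_coloring V G \<phi> \<and> (\<forall>v\<in>V. \<phi> v \<in> L v)"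
  using assms
proof (induction "card V" arbitrary: V H G rule: less_induct)
  case less
  note G = less.prems(1) and C = less.prems(2) and sub = less.prems(3) and L = less.prems(4)
  have fin: "finite V" using G by (simp add: simple_graph_def)
  have Hcases: "\<exists>x y. e = {x, y}" if "e \<in> H" for e
    using G that unfolding simple_graph_def by (metis card_2_iff)
  \<comment> \<open>The extension step, shared by the base case and the induction step:
    \<open>\<phi>\<close> colors the vertices outside \<open>S\<close>, and all edges leaving
    \<open>S\<close> end in \<open>W\<close>.\<close>
  have *: ?case if S: "S \<subseteq> V" "1 \<le> card S" "card S \<le> 2" and W: "W \<subseteq> V" "card W \<le> 2" "S \<inter> W = {}"
    and att: "\<And>x r. x \<in> S \<Longrightarrow> {x, r} \<in> H \<Longrightarrow> r \<in> S \<union> W" and injW: "inj_on \<phi> W"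
    and pr': "proper_coloring {e \<in> H. e \<inter> S = {}} \<phi>"
    and cf: "proper_conflict_free_coloring (V - S) {e \<in> G. e \<inter> S = {}} \<phi>"
    and inL: "\<And>v. v \<in> V - S \<Longrightarrow> \<phi> v \<in> L v" for S W \<phi>
  proof -
    have W': "finite W" using W fin finite_subset by blast
    have "\<exists>\<psi>. (\<forall>v. v \<notin> S \<longrightarrow> \<psi> v = \<phi> v) \<and> (\<forall>v\<in>S. \<psi> v \<in> L v) \<and> inj_on \<psi> (S \<union> W) \<and>
      (\<forall>v\<in>V. nbhd G v \<noteq> {} \<longrightarrow> (\<exists>c. \<exists>!u. u \<in> nbhd G v \<and> \<psi> u = c))"
    proof (rule extend_conflict_free)
      show "finite (L v) \<and> card (L v) = 6" if "v \<in> S" for v using L S(1) that by blast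
      show "r \<in> S \<union> W" if "x \<in> S" "{x, r} \<in> G" for x r using att that sub by blast
      show "\<exists>c. \<exists>!u. u \<in> nbhd {e \<in> G. e \<inter> S = {}} v \<and> \<phi> u = c"
        if "v \<in> V - S" "nbhd {e \<in> G. e \<inter> S = {}} v \<noteq> {}" for v
        using cf that unfolding proper_conflict_free_coloring_def by blast
    qed (use S W W' injW in auto)
    then obtain \<psi> where \<psi>: "\<And>v. v \<notin> S \<Longrightarrow> \<psi> v = \<phi> v" "\<And>v. v \<in> S \<Longrightarrow> \<psi> v \<in> L v" "inj_on \<psi> (S \<union> W)"
      "\<And>v. v \<in> V \<Longrightarrow> nbhd G v \<noteq> {} \<Longrightarrow> \<exists>c. \<exists>!u. u \<in> nbhd G v \<and> \<psi> u = c"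
      by blast
    have pc: "proper_coloring H \<psi>"
      unfolding proper_coloring_def
    proof (intro allI impI)
      fix u v assume uv: "{u, v} \<in> H"
      have ne: "u \<noteq> v" using simple_graph_edgeD[OF G uv] by simp
      show "\<psi> u \<noteq> \<psi> v"
      proof (cases "u \<in> S \<or> v \<in> S")
        case True
        then have "u \<in> S \<union> W" "v \<in> S \<union> W"
          using att[of u v] att[of v u] uv by (auto simp: insert_commute)
        then show ?thesis using \<psi>(3) ne unfolding inj_on_def by blast
      next
        case False
        then show ?thesis using pr' uv \<psi>(1) unfolding proper_coloring_def by auto
      qed
    qed
    then have "proper_coloring G \<psi>" using sub by (rule proper_coloring_subset)
    then have "proper_conflict_free_coloring V G \<psi>"
      using \<psi>(4) unfolding proper_conflict_free_coloring_def by blast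
    moreover have "\<psi> v \<in> L v" if "v \<in> V" for v using that \<psi>(1,2) inL by (cases "v \<in> S") auto
    ultimately show ?thesis using pc by blast
  qed
  show ?case
  proof (cases "card V \<le> 2")
    case True
    show ?thesis
    proof (cases "V = {}")
      case True
      then have "H = {}" using G by (auto simp: simple_graph_def)
      then show ?thesis using True sub
        by (auto simp: proper_coloring_def proper_conflict_free_coloring_def)
    next
      case False
      have emp: "{e \<in> H. e \<inter> V = {}} = {}"
        using simple_graph_edgeD[OF G] Hcases by blast
      have "1 \<le> card V" using False fin by (simp add: Suc_le_eq card_gt_0_iff)
      \<comment> \<open>All vertices are new here, so the old coloring has nothing to color and
        \<open>undefined\<close> is a placeholder.\<close>
      show ?thesis
      proof (rule *[of V "{}" "\<lambda>_. undefined"])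
        show "r \<in> V \<union> {}" if "x \<in> V" "{x, r} \<in> H" for x r
          using simple_graph_edgeD[OF G that(2)] by simp
        show "proper_coloring {e \<in> H. e \<inter> V = {}} (\<lambda>_. undefined)"
          unfolding emp by (simp add: proper_coloring_def)
        have empG: "{e \<in> G. e \<inter> V = {}} = {}" using emp sub by blast
        show "proper_conflict_free_coloring (V - V) {e \<in> G. e \<inter> V = {}} (\<lambda>_. undefined)"
          unfolding empG by (simp add: proper_conflict_free_coloring_def proper_coloring_def)
      qed (use True \<open>1 \<le> card V\<close> in auto)
    qed
  next
    case False
    then obtain p q where pq: "closed_interval pr V H p q" "1 \<le> card (between pr V p q)" "card (between pr V p q) \<le> 2"
      using exists_small_closed_interval[OF G C] by auto
    define S where "S = between pr V p q"
    define H' where "H' = insert {p, q} {e \<in> H. e \<inter> S = {}}"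
    have pqV: "p \<in> V" "q \<in> V" "p \<noteq> q" "pr p < pr q" "p \<notin> S" "q \<notin> S"
      using pq(1) by (auto simp: closed_interval_def S_def between_def)
    have SV: "S \<subseteq> V" by (auto simp: S_def between_def)
    have inj: "inj_on pr V" using C by (simp add: circular_1_planar_def)
    have sg: "simple_graph (V - S) H'"
      using G pqV unfolding simple_graph_def H'_def by auto
    \<comment> \<open>All vertices strictly between \<open>p\<close> and \<open>q\<close> have been
      deleted, so no remaining edge has an end there.\<close>
    have noalt: "\<not> alternate pr {p, q} e" "\<not> alternate pr e {p, q}" if "e \<in> H'" for e
    proof -
      have e: "e \<subseteq> V - S" using that sg unfolding simple_graph_def by blast
      have "v \<notin> e" if "pr p < pr v" "pr v < pr q" for v using e that by (auto simp: S_def between_def)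
      then have "\<not> (\<exists>a b c d. pr a < pr c \<and> pr c < pr b \<and> pr b < pr d \<and>
        ({p, q} = {a, b} \<and> e = {c, d} \<or> {p, q} = {c, d} \<and> e = {a, b}))"
        using pqV(4) by (auto simp: doubleton_eq_iff)
      then show "\<not> alternate pr {p, q} e" "\<not> alternate pr e {p, q}"
        unfolding alternate_def by blast+
    qed
    have circ: "circular_1_planar pr (V - S) H'"
      unfolding circular_1_planar_def
    proof (intro conjI ballI impI)
      show "inj_on pr (V - S)" using inj by (rule inj_on_subset) auto
      fix e f g assume efg: "e \<in> H'" "f \<in> H'" "g \<in> H'" "alternate pr e f" "alternate pr e g"
      then have "e \<noteq> {p, q}" "f \<noteq> {p, q}" "g \<noteq> {p, q}" using noalt by blast+
      then show "f = g" using efg circular_1_planarD[OF C] by (auto simp: H'_def)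
    qed
    have "card (V - S) < card V"
      using pq(2) card_mono[OF fin SV] card_Diff_subset[OF finite_subset[OF SV fin] SV]
      by (simp add: S_def[symmetric])
    moreover have "{e \<in> G. e \<inter> S = {}} \<subseteq> H'" using sub by (auto simp: H'_def)
    moreover have "finite (L v) \<and> card (L v) = 6" if "v \<in> V - S" for v using L that by simp
    ultimately have "\<exists>\<phi>. proper_coloring H' \<phi> \<and>
        proper_conflict_free_coloring (V - S) {e \<in> G. e \<inter> S = {}} \<phi> \<and> (\<forall>v\<in>V - S. \<phi> v \<in> L v)"
      using less.hyps[OF _ sg circ] by simp
    then obtain \<phi> where \<phi>: "proper_coloring H' \<phi>"
      "proper_conflict_free_coloring (V - S) {e \<in> G. e \<inter> S = {}} \<phi>" "\<forall>v\<in>V - S. \<phi> v \<in> L v"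
      by blast
    have att: "r \<in> S \<union> {p, q}" if "x \<in> S" "{x, r} \<in> H" for x r
    proof -
      have "r \<in> V" using simple_graph_edgeD[OF G that(2)] by simp
      moreover have "pr p \<le> pr r" "pr r \<le> pr q"
        using pq(1) that unfolding S_def closed_interval_def by blast+
      moreover have "r = p" if "pr r = pr p" using inj_onD[OF inj that] \<open>r \<in> V\<close> pqV by simp
      moreover have "r = q" if "pr r = pr q" using inj_onD[OF inj that] \<open>r \<in> V\<close> pqV by simp
      ultimately show ?thesis by (auto simp: S_def between_def less_le)
    qed
    have "\<phi> p \<noteq> \<phi> q" using \<phi>(1) unfolding proper_coloring_def H'_def by blast
    then have injpq: "inj_on \<phi> {p, q}" by auto
    have prS: "proper_coloring {e \<in> H. e \<inter> S = {}} \<phi>"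
      by (rule proper_coloring_subset[OF \<phi>(1)]) (auto simp: H'_def)
    show ?thesis
    proof (rule *[of S "{p, q}" \<phi>])
      show "card {p, q} \<le> 2" "S \<inter> {p, q} = {}" "{p, q} \<subseteq> V" using pqV by auto
      show "1 \<le> card S" "card S \<le> 2" using pq by (simp_all add: S_def)
      show "\<phi> v \<in> L v" if "v \<in> V - S" for v using \<phi>(3) that by blast
    qed (fact SV att injpq prS \<phi>(2))+
  qed
qed

section \<open>From the drawing to a circular order of the vertices\<close>

text \<open>By continuity an initial piece of the arc stays in the \<open>\<epsilon>\<close>-ball.
  The rest is compact and, by injectivity, misses the end point, hence avoids a small ball around
  it. The initial piece is \<open>K\<close>.\<close>

lemma arc_germ:
  fixes g :: "real \<Rightarrow> 'a::metric_space"
  assumes "arc g" "v = pathstart g \<or> v = pathfinish g" "0 < \<epsilon>"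
  obtains K \<delta> where "path_connected K" "v \<in> K" "K \<subseteq> path_image g \<inter> ball v \<epsilon>"
    "0 < \<delta>" "path_image g \<inter> ball v \<delta> \<subseteq> K"
proof -
  have *: "\<exists>K \<delta>. path_connected K \<and> pathstart g \<in> K \<and> K \<subseteq> path_image g \<inter> ball (pathstart g) \<epsilon> \<and>
      0 < \<delta> \<and> path_image g \<inter> ball (pathstart g) \<delta> \<subseteq> K" if "arc g" for g :: "real \<Rightarrow> 'a"
  proof -
    have cont: "continuous_on {0..1} g" and inj: "inj_on g {0..1}"
      using that by (auto simp: arc_def path_def)
    obtain d where d: "0 < d" "\<And>t. t \<in> {0..1} \<Longrightarrow> dist t 0 < d \<Longrightarrow> dist (g t) (g 0) < \<epsilon>"
      using cont \<open>0 < \<epsilon>\<close> unfolding continuous_on_iff by (metis atLeastAtMost_iff order_refl zero_le_one)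
    define t0 where "t0 = min (d / 2) 1"
    have t0: "0 < t0" "t0 \<le> 1" "t0 < d" using d(1) by (auto simp: t0_def)
    have "compact (g ` {t0..1})"
      using t0 by (intro compact_continuous_image continuous_on_subset[OF cont]) auto
    moreover have "g 0 \<notin> g ` {t0..1}"
    proof
      assume "g 0 \<in> g ` {t0..1}"
      then obtain t where "t \<in> {t0..1}" "g 0 = g t" by blast
      then show False using inj_onD[OF inj, of 0 t] t0 by auto
    qed
    ultimately have "open (- g ` {t0..1})" "g 0 \<in> - g ` {t0..1}"
      by (simp_all add: compact_imp_closed open_Compl)
    then obtain \<delta> where \<delta>: "0 < \<delta>" "ball (g 0) \<delta> \<subseteq> - g ` {t0..1}"
      by (meson open_contains_ball)
    show ?thesis
    proof (intro exI[of _ "g ` {0..t0}"] exI[of _ \<delta>] conjI)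
      show "path_connected (g ` {0..t0})"
        using t0 by (intro path_connected_continuous_image continuous_on_subset[OF cont])
          (auto simp: convex_imp_path_connected)
      show "pathstart g \<in> g ` {0..t0}" using t0 by (auto simp: pathstart_def)
      show "g ` {0..t0} \<subseteq> path_image g \<inter> ball (pathstart g) \<epsilon>"
        using t0 d(2) by (auto simp: path_image_def pathstart_def dist_commute)
      show "path_image g \<inter> ball (pathstart g) \<delta> \<subseteq> g ` {0..t0}"
      proof
        fix z assume z: "z \<in> path_image g \<inter> ball (pathstart g) \<delta>"
        then obtain t where t: "t \<in> {0..1}" "z = g t" by (auto simp: path_image_def)
        have "t \<notin> {t0..1}" using z t \<delta>(2) by (auto simp: pathstart_def)
        then show "z \<in> g ` {0..t0}" using t by auto
      qed
    qed (use \<delta> in auto)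
  qed
  have "\<exists>K \<delta>. path_connected K \<and> v \<in> K \<and> K \<subseteq> path_image g \<inter> ball v \<epsilon> \<and>
      0 < \<delta> \<and> path_image g \<inter> ball v \<delta> \<subseteq> K"
    using assms(2)
  proof
    assume "v = pathstart g" then show ?thesis using *[OF assms(1)] by simp
  next
    assume "v = pathfinish g" then show ?thesis using *[OF arc_reversepath[OF assms(1)]] by simp
  qed
  then show thesis using that by blast
qed

text \<open>Germs of single arcs are glued at \<open>v\<close>. Since \<open>K\<close> contains all
  of the star close to \<open>v\<close>, a leg landing there can be continued to \<open>v\<close>
  inside \<open>K\<close>. The \<open>insert v\<close> covers an isolated vertex, where
  \<open>F\<close> is empty.\<close>

lemma star_germ:
  fixes \<gamma> :: "'b \<Rightarrow> real \<Rightarrow> 'a::metric_space"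
  assumes "finite F" "\<And>e. e \<in> F \<Longrightarrow> arc (\<gamma> e) \<and> (v = pathstart (\<gamma> e) \<or> v = pathfinish (\<gamma> e))" "0 < \<epsilon>"
  shows "\<exists>K \<delta>. path_connected K \<and> v \<in> K \<and> K \<subseteq> insert v (\<Union>e\<in>F. path_image (\<gamma> e)) \<inter> ball v \<epsilon> \<and>
      0 < \<delta> \<and> (\<Union>e\<in>F. path_image (\<gamma> e)) \<inter> ball v \<delta> \<subseteq> K"
  using assms(1,2)
proof (induction F)
  case empty
  show ?case using assms(3) by (intro exI[of _ "{v}"] exI[of _ 1]) auto
next
  case (insert f F)
  have f: "arc (\<gamma> f)" "v = pathstart (\<gamma> f) \<or> v = pathfinish (\<gamma> f)" using insert.prems[of f] by auto
  have "\<exists>K \<delta>. path_connected K \<and> v \<in> K \<and> K \<subseteq> insert v (\<Union>e\<in>F. path_image (\<gamma> e)) \<inter> ball v \<epsilon> \<and>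
      0 < \<delta> \<and> (\<Union>e\<in>F. path_image (\<gamma> e)) \<inter> ball v \<delta> \<subseteq> K"
    by (rule insert.IH) (use insert.prems in blast)
  then obtain K \<delta> where K: "path_connected K" "v \<in> K" "K \<subseteq> insert v (\<Union>e\<in>F. path_image (\<gamma> e)) \<inter> ball v \<epsilon>"
      "0 < \<delta>" "(\<Union>e\<in>F. path_image (\<gamma> e)) \<inter> ball v \<delta> \<subseteq> K"
    by blast
  obtain K' \<delta>' where K': "path_connected K'" "v \<in> K'" "K' \<subseteq> path_image (\<gamma> f) \<inter> ball v \<epsilon>"
      "0 < \<delta>'" "path_image (\<gamma> f) \<inter> ball v \<delta>' \<subseteq> K'"
    by (rule arc_germ[OF f assms(3)])
  show ?case
  proof (intro exI[of _ "K \<union> K'"] exI[of _ "min \<delta> \<delta>'"] conjI)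
    show "path_connected (K \<union> K')" using K(1,2) K'(1,2) by (intro path_connected_Un) auto
    show "(\<Union>e\<in>insert f F. path_image (\<gamma> e)) \<inter> ball v (min \<delta> \<delta>') \<subseteq> K \<union> K'"
      using K(5) K'(5) by (auto simp: subset_iff)
  qed (use K K' in auto)
qed

section \<open>Disjoint legs down to a line below the drawing\<close>

text \<open>Start at an outer point \<open>u\<close> near \<open>v\<close>. Going straight towards
  \<open>v\<close>, one first hits \<open>D\<close> at some \<open>z\<close> close to
  \<open>v\<close>; in the other direction \<open>conn\<close> leads from \<open>u\<close> below the
  line at height \<open>r\<close>. The joined path is cut at that line and thinned to an
  arc.\<close>

lemma exists_leg:
  fixes D L :: "complex set"
  assumes D: "compact D" and L: "compact L"
    and conn: "\<And>p q. p \<in> outside D - L \<Longrightarrow> q \<in> outside D - L \<Longrightarrow> connected_component (- (D \<union> L)) p q"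
    and v: "v \<in> closure (outside D)" "v \<in> D" "v \<notin> L" and \<delta>: "0 < \<delta>"
    and above: "\<And>z. z \<in> D \<Longrightarrow> r < Im z" "\<And>z. z \<in> L \<Longrightarrow> r \<le> Im z"
  obtains g where "arc g" "dist v (pathstart g) < \<delta>" "Im (pathfinish g) = r"
    "\<And>z. z \<in> path_image g \<Longrightarrow> r \<le> Im z" "path_image g \<inter> D = {pathstart g}" "path_image g \<inter> L = {}"
proof -
  have closed: "closed D" "closed L" using D L by (auto simp: compact_imp_closed)
  obtain \<eta> where \<eta>: "0 < \<eta>" "ball v \<eta> \<subseteq> - L"
    using open_contains_ball[of "- L"] closed v(3) by auto
  \<comment> \<open>Within this ball the segment from \<open>u\<close> to \<open>v\<close> cannot
    meet the earlier legs \<open>L\<close>.\<close>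
  define \<delta>' where "\<delta>' = min \<delta> \<eta>"
  have \<delta>': "0 < \<delta>'" "\<delta>' \<le> \<delta>" "ball v \<delta>' \<inter> L = {}" using \<delta> \<eta> by (auto simp: \<delta>'_def)
  obtain u where u: "u \<in> outside D" "u \<in> ball v \<delta>'"
    using v(1) \<delta>'(1) by (auto simp: closure_approachable dist_commute)
  have uD: "u \<notin> D" using u(1) outside_no_overlap[of D] by blast
  have "path (linepath u v)" "pathstart (linepath u v) \<in> closure (- D)" "pathfinish (linepath u v) \<notin> - D"
    using uD v(2) closure_subset[of "- D"] by auto
  from exists_path_subpath_to_frontier[OF this]
  obtain h where h: "path h" "pathstart h = u" "path_image h \<subseteq> closed_segment u v"
      "path_image h - {pathfinish h} \<subseteq> interior (- D)" "pathfinish h \<in> frontier (- D)" by auto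
  define z where "z = pathfinish h"
  have zD: "z \<in> D" using h(5) frontier_subset_closed[OF closed(1)] by (auto simp: z_def frontier_complement)
  have hD: "path_image h \<inter> D \<subseteq> {z}" using h(4) interior_subset by (auto simp: z_def)
  have hball: "path_image h \<subseteq> ball v \<delta>'"
    using h(3) u(2) \<delta>'(1) closed_segment_subset[of u "ball v \<delta>'" v] by (auto simp: convex_ball)
  have zball: "z \<in> ball v \<delta>'" using hball pathfinish_in_path_image[of h] by (auto simp: z_def)
  \<comment> \<open>The half-plane at or below height \<open>r\<close> avoids \<open>D\<close> and
    has a convex complement, so it belongs to the outer face; \<open>w\<close> is moreover below all
    earlier legs.\<close>
  define w where "w = Complex 0 (r - 1)"
  have "- {z. r < Im z} \<subseteq> outside D"
    using above(1) by (intro outside_subset_convex) (auto simp: convex_halfspace_Im_gt)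
  then have "w \<in> outside D - L" using above(2)[of w] by (auto simp: w_def)
  moreover have "u \<in> outside D - L" using u \<delta>' by auto
  ultimately have "connected_component (- (D \<union> L)) u w" by (intro conn)
  then have "path_component (- (D \<union> L)) u w"
    using open_path_connected_component[of "- (D \<union> L)"] closed by (metis closed_Un open_Compl)
  then obtain p where p: "path p" "path_image p \<subseteq> - (D \<union> L)" "pathstart p = u" "pathfinish p = w"
    unfolding path_component_def by blast
  define q where "q = reversepath h +++ p"
  have q: "path q" "pathstart q = z" "pathfinish q = w" "path_image q = path_image h \<union> path_image p"
    using h p by (auto simp: q_def z_def path_image_join)
  have cl: "closed {y. r \<le> Im y}" by (simp add: closed_halfspace_Im_ge)
  obtain k where k: "path k" "pathstart k = z" "path_image k \<subseteq> path_image q \<inter> {y. r \<le> Im y}"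
      "pathfinish k \<in> frontier {y. r \<le> Im y}"
    using exists_path_subpath_to_frontier_closed[OF cl q(1)] q(2,3) above(1)[OF zD] by (auto simp: w_def)
  have Imk: "Im (pathfinish k) = r"
  proof -
    have "{y. r < Im y} \<subseteq> interior {y. r \<le> Im y}"
      by (intro interior_maximal) (auto simp: open_halfspace_Im_gt)
    moreover have "pathfinish k \<in> {y. r \<le> Im y}" "pathfinish k \<notin> interior {y. r \<le> Im y}"
      using k(4) frontier_subset_closed[OF cl] by (auto simp: frontier_def)
    ultimately show ?thesis by force
  qed
  \<comment> \<open>\<open>D\<close> lies strictly above the line, so the ends differ and an arc can
    be extracted.\<close>
  have "pathstart k \<noteq> pathfinish k" using above(1)[OF zD] Imk k(2) by auto
  then obtain g where g: "arc g" "path_image g \<subseteq> path_image k" "pathstart g = z" "pathfinish g = pathfinish k"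
    using path_contains_arc[of k z "pathfinish k"] k by blast
  have sub: "path_image g \<subseteq> path_image h \<union> path_image p" using g(2) k(3) q(4) by blast
  have "z \<in> path_image g" using g(3) pathstart_in_path_image by metis
  then have "path_image g \<inter> D = {z}" using sub hD p(2) zD by blast
  moreover have "path_image g \<inter> L = {}" using sub hball \<delta>'(3) p(2) by blast
  moreover have "\<And>y. y \<in> path_image g \<Longrightarrow> r \<le> Im y" using g(2) k(3) by blast
  moreover have "dist v (pathstart g) < \<delta>" using zball \<delta>'(2) g(3) by simp
  ultimately show thesis
    using that[OF g(1)] g(3,4) Imk by simp
qed

text \<open>A leg starts somewhere in \<open>K v\<close>, not necessarily at the vertex; the
  connected set \<open>K v\<close> later supplies the missing link.\<close>

definition legs :: "complex set \<Rightarrow> real \<Rightarrow> 'a set \<Rightarrow> ('a \<Rightarrow> complex set) \<Rightarrow> ('a \<Rightarrow> real \<Rightarrow> complex) \<Rightarrow> bool" where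
  "legs D r V K l \<longleftrightarrow>
     (\<forall>v\<in>V. arc (l v) \<and> pathstart (l v) \<in> K v \<and> Im (pathfinish (l v)) = r \<and>
        (\<forall>z\<in>path_image (l v). r \<le> Im z) \<and> path_image (l v) \<inter> D = {pathstart (l v)}) \<and>
     (\<forall>u\<in>V. \<forall>v\<in>V. u \<noteq> v \<longrightarrow> path_image (l u) \<inter> path_image (l v) = {})"

text \<open>
  The induction also carries that the outer face minus the legs chosen so far is connected: a new
  leg touches the union of drawing and old legs in a single point and does not separate the plane,
  so Janiszewski's theorem applies.
\<close>
lemma exists_legs:
  fixes D :: "complex set"
  assumes "finite V" and D: "compact D" and above: "\<And>z. z \<in> D \<Longrightarrow> r < Im z"
    and pos: "\<And>v. v \<in> V \<Longrightarrow> pos v \<in> closure (outside D) \<inter> D \<inter> K v"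
    and germ: "\<And>v. v \<in> V \<Longrightarrow> 0 < \<delta> v \<and> D \<inter> ball (pos v) (\<delta> v) \<subseteq> K v"
    and disj: "\<And>u v. u \<in> V \<Longrightarrow> v \<in> V \<Longrightarrow> u \<noteq> v \<Longrightarrow> K u \<inter> K v = {}"
  shows "\<exists>l. legs D r V K l"
proof -
  have "\<exists>l. legs D r V K l \<and> (\<forall>p q. p \<in> outside D - (\<Union>v\<in>V. path_image (l v)) \<longrightarrow>
      q \<in> outside D - (\<Union>v\<in>V. path_image (l v)) \<longrightarrow>
      connected_component (- (D \<union> (\<Union>v\<in>V. path_image (l v)))) p q)"
    using assms(1) pos germ disj
  proof (induction V)
    case empty
    have "connected (outside D)" using D by (intro connected_outside) (auto simp: compact_imp_bounded)
    then have "connected_component (- D) p q" if "p \<in> outside D" "q \<in> outside D" for p q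
      using that outside_no_overlap[of D] unfolding connected_component_def by blast
    then show ?case by (auto simp: legs_def)
  next
    case (insert x V)
    have "\<exists>l. legs D r V K l \<and> (\<forall>p q. p \<in> outside D - (\<Union>v\<in>V. path_image (l v)) \<longrightarrow>
        q \<in> outside D - (\<Union>v\<in>V. path_image (l v)) \<longrightarrow>
        connected_component (- (D \<union> (\<Union>v\<in>V. path_image (l v)))) p q)"
      by (rule insert.IH) (use insert.prems in auto)
    then obtain l where l: "legs D r V K l" and conn: "\<And>p q. p \<in> outside D - (\<Union>v\<in>V. path_image (l v)) \<Longrightarrow>
        q \<in> outside D - (\<Union>v\<in>V. path_image (l v)) \<Longrightarrow>
        connected_component (- (D \<union> (\<Union>v\<in>V. path_image (l v)))) p q"
      by blast
    let ?L = "\<Union>v\<in>V. path_image (l v)"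
    have lv: "arc (l v)" "pathstart (l v) \<in> K v" "Im (pathfinish (l v)) = r"
        "\<And>z. z \<in> path_image (l v) \<Longrightarrow> r \<le> Im z" "path_image (l v) \<inter> D = {pathstart (l v)}" if "v \<in> V" for v
      using l that unfolding legs_def by blast+
    have compL: "compact ?L" using lv(1) insert.hyps(1) by (intro compact_UN) (auto simp: compact_arc_image)
    have px: "pos x \<in> closure (outside D)" "pos x \<in> D" "pos x \<in> K x" using insert.prems(1) by auto
    \<comment> \<open>An old leg meets \<open>D\<close> only at its start, which lies in a star
      disjoint from \<open>K x\<close>.\<close>
    have "pos x \<notin> ?L"
    proof
      assume "pos x \<in> ?L"
      then obtain v where v: "v \<in> V" "pos x \<in> path_image (l v)" by blast
      then have "pos x = pathstart (l v)" using lv(5)[OF v(1)] px(2) by blast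
      then have "pos x \<in> K v" using lv(2)[OF v(1)] by simp
      then show False using insert.prems(3)[of x v] px(3) v(1) insert.hyps(2) by blast
    qed
    moreover have "\<And>z. z \<in> ?L \<Longrightarrow> r \<le> Im z" using lv(4) by blast
    moreover have dx: "0 < \<delta> x" "D \<inter> ball (pos x) (\<delta> x) \<subseteq> K x" using insert.prems(2) by auto
    ultimately obtain g where g: "arc g" "dist (pos x) (pathstart g) < \<delta> x" "Im (pathfinish g) = r"
        "\<And>z. z \<in> path_image g \<Longrightarrow> r \<le> Im z" "path_image g \<inter> D = {pathstart g}" "path_image g \<inter> ?L = {}"
      using exists_leg[OF D compL conn px(1,2) _ _ above] by metis
    define l' where "l' = l(x := g)"
    have l'V: "l' v = l v" if "v \<in> V" for v using that insert.hyps(2) by (auto simp: l'_def)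
    have l'x: "l' x = g" by (simp add: l'_def)
    have gK: "pathstart g \<in> K x" using g(2,5) dx(2) by auto
    have "legs D r (insert x V) K l'"
      unfolding legs_def
    proof (intro conjI ballI impI)
      fix v assume v: "v \<in> insert x V"
      have "v = x \<or> v \<in> V \<and> l' v = l v" using v l'V by blast
      then show "arc (l' v)" "pathstart (l' v) \<in> K v" "Im (pathfinish (l' v)) = r"
        "path_image (l' v) \<inter> D = {pathstart (l' v)}"
        using lv(1,2,3,5)[of v] g(1,3,5) gK l'x by auto
      fix z assume "z \<in> path_image (l' v)"
      then show "r \<le> Im z" using \<open>v = x \<or> v \<in> V \<and> l' v = l v\<close> lv(4)[of v z] g(4)[of z] l'x by auto
    next
      fix u v assume uv: "u \<in> insert x V" "v \<in> insert x V" "u \<noteq> v"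
      consider "u = x" "v \<in> V" | "v = x" "u \<in> V" | "u \<in> V" "v \<in> V" using uv by blast
      then show "path_image (l' u) \<inter> path_image (l' v) = {}"
      proof cases
        case 3
        then show ?thesis using l uv(3) l'V unfolding legs_def by metis
      qed (use g(6) l'V l'x in auto)
    qed
    moreover have eq: "(\<Union>v\<in>insert x V. path_image (l' v)) = ?L \<union> path_image g"
      using l'V l'x by auto
    moreover have "connected_component (- (D \<union> (?L \<union> path_image g))) p q"
      if "p \<in> outside D - (?L \<union> path_image g)" "q \<in> outside D - (?L \<union> path_image g)" for p q
    proof -
      have "connected_component (- ((D \<union> ?L) \<union> path_image g)) p q"
      proof (rule Janiszewski)
        show "compact (D \<union> ?L)" using D compL by (rule compact_Un)
        show "closed (path_image g)" using g(1) by (simp add: closed_arc_image)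
        have "(D \<union> ?L) \<inter> path_image g = {pathstart g}" using g(5,6) by blast
        then show "connected ((D \<union> ?L) \<inter> path_image g)" by simp
        show "connected_component (- (D \<union> ?L)) p q" using conn that by blast
        have "connected (- path_image g)" using g(1) by (intro connected_arc_complement) auto
        then show "connected_component (- path_image g) p q"
          using that unfolding connected_component_def by blast
      qed
      then show ?thesis by (simp add: Un_assoc)
    qed
    ultimately show ?case by (intro exI[of _ l']) simp
  qed
  then show ?thesis by blast
qed

section \<open>Alternating edges cross\<close>

text \<open>Both paths fit into a rectangle whose bottom side lies on the line at height
  \<open>r\<close>, with their ends interlaced there. This is \<open>fashoda_interlace\<close>,
  transported from \<open>real^2\<close> by \<open>T\<close>.\<close>

lemma interlaced_paths_meet:
  fixes f g :: "real \<Rightarrow> complex"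
  assumes "path f" "path g" "\<And>z. z \<in> path_image f \<union> path_image g \<Longrightarrow> r \<le> Im z"
    and "Im (pathstart f) = r" "Im (pathfinish f) = r" "Im (pathstart g) = r" "Im (pathfinish g) = r"
    and "Re (pathstart f) < Re (pathstart g)" "Re (pathstart g) < Re (pathfinish f)"
      "Re (pathfinish f) < Re (pathfinish g)"
  shows "path_image f \<inter> path_image g \<noteq> {}"
proof -
  define T :: "complex \<Rightarrow> real^2" where "T z = (\<chi> i. if i = 1 then Re z else Im z)" for z
  have T: "T z $ 1 = Re z" "T z $ 2 = Im z" for z by (simp_all add: T_def)
  have "continuous_on S T" for S
  proof -
    have "continuous_on S (\<lambda>z. if i = 1 then Re z else Im z)" for i :: 2
      by (cases "i = 1") (auto intro!: continuous_intros)
    then show ?thesis unfolding T_def by (intro continuous_on_vec_lambda)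
  qed
  then have path: "path (T \<circ> f)" "path (T \<circ> g)" using assms(1,2) by (auto intro: path_continuous_image)
  have "bounded (path_image f \<union> path_image g)"
    using assms(1,2) by (simp add: bounded_path_image)
  then obtain B where B: "\<And>z. z \<in> path_image f \<union> path_image g \<Longrightarrow> norm z \<le> B"
    unfolding bounded_iff by blast
  have ReB: "- B \<le> Re z" "Re z \<le> B" "Im z \<le> B" if "z \<in> path_image f \<union> path_image g" for z
    using B[OF that] abs_Re_le_cmod[of z] abs_Im_le_cmod[of z] by linarith+
  have box: "T z \<in> cbox (T (Complex (- B) r)) (T (Complex B B))" if "z \<in> path_image f \<union> path_image g" for z
    using ReB[OF that] assms(3)[OF that] by (simp add: mem_box_cart forall_2 T)
  have img: "path_image (T \<circ> f) \<subseteq> cbox (T (Complex (- B) r)) (T (Complex B B))"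
      "path_image (T \<circ> g) \<subseteq> cbox (T (Complex (- B) r)) (T (Complex B B))"
    using box by (auto simp: path_image_compose)
  obtain z where "z \<in> path_image (T \<circ> f)" "z \<in> path_image (T \<circ> g)"
    by (rule fashoda_interlace[OF path img])
      (use assms in \<open>auto simp: pathstart_compose pathfinish_compose T\<close>)
  then obtain x y where xy: "x \<in> path_image f" "y \<in> path_image g" "T x = T y"
    by (auto simp: path_image_compose)
  then have "x = y" using T by (metis complex_eqI)
  then show ?thesis using xy by blast
qed

text \<open>Order the vertices by the feet of their legs. An edge extended by the stars and legs of
  its ends connects two feet above the line, so the extensions of alternating edges meet. Stars and
  legs avoid everything not incident with their vertex, so the meeting point lies on the edges
  themselves.\<close>

lemma outer_1_planar_imp_circular:
  assumes G: "simple_graph V E" and P: "outer_1_planar V E"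
  obtains pr where "circular_1_planar pr V E"
proof -
  obtain pos \<gamma> where dr: "drawing V E pos \<gamma>"
    and fr: "\<And>v. v \<in> V \<Longrightarrow> pos v \<in> frontier (outside (drawing_image V E pos \<gamma>))"
    and cr: "\<And>e. e \<in> E \<Longrightarrow> finite (crossings V E pos \<gamma> e) \<and> card (crossings V E pos \<gamma> e) \<le> 1"
    using P unfolding outer_1_planar_def by blast
  define D where "D = drawing_image V E pos \<gamma>"
  have finV: "finite V" and edge: "\<And>e. e \<in> E \<Longrightarrow> e \<subseteq> V" using G by (auto simp: simple_graph_def)
  have finE: "finite E" using edge finV by (metis PowI finite_Pow_iff finite_subset subsetI)
  have inj: "inj_on pos V" and arc: "\<And>e. e \<in> E \<Longrightarrow> arc (\<gamma> e)"
    and ends: "\<And>e. e \<in> E \<Longrightarrow> {pathstart (\<gamma> e), pathfinish (\<gamma> e)} = pos ` e"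
    and meets: "\<And>e. e \<in> E \<Longrightarrow> path_image (\<gamma> e) \<inter> pos ` V = pos ` e"
    using dr unfolding drawing_def by blast+
  have pos_on: "pos v \<in> path_image (\<gamma> e) \<longleftrightarrow> v \<in> e" if "e \<in> E" "v \<in> V" for e v
    using meets[OF that(1)] that(2) edge[OF that(1)] inj_on_image_mem_iff[OF inj that(2)] by blast
  have comp: "compact ((\<Union>e\<in>F. path_image (\<gamma> e)) \<union> pos ` W)" if "F \<subseteq> E" "W \<subseteq> V" for F W
  proof (rule compact_Un)
    show "compact (\<Union>e\<in>F. path_image (\<gamma> e))"
      using finite_subset[OF that(1) finE] arc that(1) by (intro compact_UN) (auto simp: compact_arc_image)
    show "compact (pos ` W)"
      using finite_subset[OF that(2) finV] by (simp add: finite_imp_compact)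
  qed
  have D: "compact D"
    using comp[OF order_refl order_refl] by (simp add: D_def drawing_image_def Un_commute)
  obtain B where B: "\<And>z. z \<in> D \<Longrightarrow> norm z \<le> B"
    using compact_imp_bounded[OF D] unfolding bounded_iff by blast
  define r where "r = - B - 1"
  have above: "r < Im z" if "z \<in> D" for z
    using B[OF that] abs_Im_le_cmod[of z] by (simp add: r_def)
  have posD: "pos v \<in> D" if "v \<in> V" for v using that by (auto simp: D_def drawing_image_def)
  have \<gamma>D: "path_image (\<gamma> e) \<subseteq> D" if "e \<in> E" for e using that by (auto simp: D_def drawing_image_def)
  \<comment> \<open>The part of the drawing not incident with \<open>v\<close>; it is compact and
    misses \<open>pos v\<close>, so it leaves a ball of radius \<open>\<epsilon> v\<close>
    free.\<close>
  define far where "far v = (\<Union>e\<in>{e \<in> E. v \<notin> e}. path_image (\<gamma> e)) \<union> pos ` (V - {v})" for v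
  have "\<exists>\<epsilon>>0. ball (pos v) \<epsilon> \<inter> far v = {}" if "v \<in> V" for v
  proof -
    have "compact (far v)"
      unfolding far_def by (intro comp) auto
    then have "open (- far v)" by (simp add: compact_imp_closed open_Compl)
    moreover have "pos v \<notin> pos ` (V - {v})" using inj that by (auto simp: inj_on_def)
    then have "pos v \<in> - far v" using pos_on that by (auto simp: far_def)
    ultimately obtain \<epsilon> where "\<epsilon> > 0" "ball (pos v) \<epsilon> \<subseteq> - far v" by (meson open_contains_ball)
    then show ?thesis by blast
  qed
  then obtain \<epsilon> where \<epsilon>: "\<And>v. v \<in> V \<Longrightarrow> 0 < \<epsilon> v" "\<And>v. v \<in> V \<Longrightarrow> ball (pos v) (\<epsilon> v) \<inter> far v = {}"
    by metis
  \<comment> \<open>The radius is halved so that stars of different vertices are disjoint: a common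
    point would bring two vertices closer than the larger of their radii.\<close>
  have "\<exists>K \<delta>. path_connected K \<and> pos v \<in> K \<and> K \<subseteq> D \<inter> ball (pos v) (\<epsilon> v / 2) \<and>
      0 < \<delta> \<and> D \<inter> ball (pos v) \<delta> \<subseteq> K" if "v \<in> V" for v
  proof -
    let ?F = "{e \<in> E. v \<in> e}"
    have "\<exists>K \<delta>. path_connected K \<and> pos v \<in> K \<and>
        K \<subseteq> insert (pos v) (\<Union>e\<in>?F. path_image (\<gamma> e)) \<inter> ball (pos v) (\<epsilon> v / 2) \<and>
        0 < \<delta> \<and> (\<Union>e\<in>?F. path_image (\<gamma> e)) \<inter> ball (pos v) \<delta> \<subseteq> K"
    proof (rule star_germ)
      show "arc (\<gamma> e) \<and> (pos v = pathstart (\<gamma> e) \<or> pos v = pathfinish (\<gamma> e))" if "e \<in> ?F" for e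
        using arc ends[of e] that by (metis (no_types, lifting) imageI insert_iff mem_Collect_eq singletonD)
    qed (use finE \<epsilon> that in auto)
    then obtain K \<delta> where K: "path_connected K" "pos v \<in> K"
      "K \<subseteq> insert (pos v) (\<Union>e\<in>?F. path_image (\<gamma> e)) \<inter> ball (pos v) (\<epsilon> v / 2)"
      "0 < \<delta>" "(\<Union>e\<in>?F. path_image (\<gamma> e)) \<inter> ball (pos v) \<delta> \<subseteq> K"
      by (elim exE conjE)
    have "D \<subseteq> insert (pos v) (\<Union>e\<in>?F. path_image (\<gamma> e)) \<union> far v"
      by (auto simp: D_def drawing_image_def far_def)
    moreover have "ball (pos v) (min \<delta> (\<epsilon> v)) = ball (pos v) \<delta> \<inter> ball (pos v) (\<epsilon> v)"
      by auto
    ultimately have "D \<inter> ball (pos v) (min \<delta> (\<epsilon> v)) \<subseteq> K"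
      using K(2,5) \<epsilon>(2)[OF that] by blast
    moreover have "insert (pos v) (\<Union>e\<in>?F. path_image (\<gamma> e)) \<subseteq> D"
      using posD[OF that] \<gamma>D by blast
    then have "K \<subseteq> D \<inter> ball (pos v) (\<epsilon> v / 2)" using K(3) by (meson Int_mono order_refl order_trans)
    moreover have "0 < min \<delta> (\<epsilon> v)" using K(4) \<epsilon>(1)[OF that] by simp
    ultimately show ?thesis using K(1,2) by metis
  qed
  then obtain K \<delta> where K: "\<And>v. v \<in> V \<Longrightarrow> path_connected (K v)" "\<And>v. v \<in> V \<Longrightarrow> pos v \<in> K v"
    "\<And>v. v \<in> V \<Longrightarrow> K v \<subseteq> D \<inter> ball (pos v) (\<epsilon> v / 2)"
    and \<delta>: "\<And>v. v \<in> V \<Longrightarrow> 0 < \<delta> v \<and> D \<inter> ball (pos v) (\<delta> v) \<subseteq> K v"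
    by metis
  have K\<gamma>: "K v \<inter> path_image (\<gamma> e) = {}" if "v \<in> V" "e \<in> E" "v \<notin> e" for v e
  proof -
    have "path_image (\<gamma> e) \<subseteq> far v" using that by (auto simp: far_def)
    moreover have "ball (pos v) (\<epsilon> v / 2) \<subseteq> ball (pos v) (\<epsilon> v)" using \<epsilon>(1)[OF that(1)] by (intro subset_ball) simp
    ultimately show ?thesis using K(3)[OF that(1)] \<epsilon>(2)[OF that(1)] by blast
  qed
  have KK: "K u \<inter> K v = {}" if "u \<in> V" "v \<in> V" "u \<noteq> v" for u v
  proof (rule ccontr)
    assume "K u \<inter> K v \<noteq> {}"
    then obtain z where "z \<in> K u" "z \<in> K v" by blast
    then have "dist (pos u) z < \<epsilon> u / 2" "dist (pos v) z < \<epsilon> v / 2" using K(3) that(1,2) by fastforce+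
    moreover have "pos v \<in> far u" "pos u \<in> far v" using that by (auto simp: far_def)
    then have "\<not> dist (pos u) (pos v) < \<epsilon> u" "\<not> dist (pos v) (pos u) < \<epsilon> v"
      using \<epsilon>(2) that(1,2) by (auto simp: disjoint_iff)
    ultimately show False using dist_triangle2[of "pos u" "pos v" z] by (simp add: dist_commute)
  qed
  have "\<exists>l. legs D r V K l"
  proof (rule exists_legs[where pos = pos and \<delta> = \<delta>, OF finV D])
    show "pos v \<in> closure (outside D) \<inter> D \<inter> K v" if "v \<in> V" for v
      using fr[OF that] posD[OF that] K(2)[OF that] by (simp add: frontier_def D_def)
  qed (fact above \<delta> KK)+
  then obtain l where "legs D r V K l" by blast
  then have l: "arc (l v)" "pathstart (l v) \<in> K v" "Im (pathfinish (l v)) = r"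
      "\<And>z. z \<in> path_image (l v) \<Longrightarrow> r \<le> Im z" "path_image (l v) \<inter> D = {pathstart (l v)}"
    and ll: "\<And>u. u \<in> V \<Longrightarrow> u \<noteq> v \<Longrightarrow> path_image (l u) \<inter> path_image (l v) = {}" if "v \<in> V" for v
    using that unfolding legs_def by blast+
  define pr where "pr v = Re (pathfinish (l v))" for v
  have "inj_on pr V"
  proof (rule inj_onI, rule ccontr)
    fix u v assume uv: "u \<in> V" "v \<in> V" "pr u = pr v" "u \<noteq> v"
    then have "pathfinish (l u) = pathfinish (l v)" by (intro complex_eqI) (simp_all add: pr_def l(3))
    then show False using ll[OF uv(2,1,4)] pathfinish_in_path_image by fastforce
  qed
  \<comment> \<open>Leg and star act as one enlarged vertex, connected and reaching from the line to
    \<open>pos v\<close>.\<close>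
  define T where "T v = path_image (l v) \<union> K v" for v
  have leg_near: "path_image (l v) \<inter> D \<subseteq> K v" if "v \<in> V" for v using l(2,5)[OF that] by simp
  have TT: "T u \<inter> T v = {}" if "u \<in> V" "v \<in> V" "u \<noteq> v" for u v
    using ll[OF that(2,1,3)] KK[OF that] leg_near[OF that(1)] leg_near[OF that(2)] K(3)[OF that(1)] K(3)[OF that(2)]
    unfolding T_def by blast
  have T\<gamma>: "T v \<inter> path_image (\<gamma> e) = {}" if "v \<in> V" "e \<in> E" "v \<notin> e" for v e
    using leg_near[OF that(1)] K\<gamma>[OF that] \<gamma>D[OF that(2)] unfolding T_def by blast
  have Tconn: "path_connected (T v)" if "v \<in> V" for v
    unfolding T_def
  proof (rule path_connected_Un)
    show "path_connected (path_image (l v))" using l(1)[OF that] by (simp add: arc_imp_path path_connected_path_image)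
    show "path_image (l v) \<inter> K v \<noteq> {}" using l(2)[OF that] pathstart_in_path_image by blast
  qed (use K that in auto)
  define A where "A a b = T a \<union> path_image (\<gamma> {a, b}) \<union> T b" for a b
  have route: "\<exists>f. path f \<and> path_image f \<subseteq> A a b \<and> pathstart f = pathfinish (l a) \<and> pathfinish f = pathfinish (l b)"
    and A_above: "\<And>z. z \<in> A a b \<Longrightarrow> r \<le> Im z" if ab: "{a, b} \<in> E" for a b
  proof -
    have V: "a \<in> V" "b \<in> V" using edge[OF ab] by auto
    have "pos a \<in> T a \<inter> path_image (\<gamma> {a, b})" "pos b \<in> path_image (\<gamma> {a, b}) \<inter> T b"
      using K(2) V pos_on[OF ab] by (auto simp: T_def)
    then have "path_connected (A a b)"
      unfolding A_def using Tconn V arc[OF ab]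
      by (intro path_connected_Un) (auto simp: arc_imp_path path_connected_path_image)
    moreover have "pathfinish (l a) \<in> A a b" "pathfinish (l b) \<in> A a b" by (auto simp: A_def T_def)
    ultimately show "\<exists>f. path f \<and> path_image f \<subseteq> A a b \<and> pathstart f = pathfinish (l a) \<and> pathfinish f = pathfinish (l b)"
      unfolding path_connected_def by blast
    show "r \<le> Im z" if "z \<in> A a b" for z
    proof (cases "z \<in> D")
      case True then show ?thesis using above by fastforce
    next
      case False
      then have "z \<in> path_image (l a) \<union> path_image (l b)"
        using that K(3)[OF V(1)] K(3)[OF V(2)] \<gamma>D[OF ab] by (auto simp: A_def T_def)
      then show ?thesis using l(4) V by blast
    qed
  qed
  have cross: "\<exists>p. p \<in> path_image (\<gamma> {a, b}) \<inter> path_image (\<gamma> {c, d}) - pos ` V"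
    if E: "{a, b} \<in> E" "{c, d} \<in> E" and lt: "pr a < pr c" "pr c < pr b" "pr b < pr d" for a b c d
  proof -
    have V: "a \<in> V" "b \<in> V" "c \<in> V" "d \<in> V" using edge E by blast+
    have ne: "a \<noteq> c" "a \<noteq> d" "b \<noteq> c" "b \<noteq> d" using lt by auto
    obtain f where f: "path f" "path_image f \<subseteq> A a b" "pathstart f = pathfinish (l a)" "pathfinish f = pathfinish (l b)"
      using route[OF E(1)] by blast
    obtain g where g: "path g" "path_image g \<subseteq> A c d" "pathstart g = pathfinish (l c)" "pathfinish g = pathfinish (l d)"
      using route[OF E(2)] by blast
    have "path_image f \<inter> path_image g \<noteq> {}"
    proof (rule interlaced_paths_meet[OF f(1) g(1)])
      show "r \<le> Im z" if "z \<in> path_image f \<union> path_image g" for z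
        using that f(2) g(2) A_above[OF E(1)] A_above[OF E(2)] by blast
    qed (use f g lt l(3) V in \<open>auto simp: pr_def\<close>)
    then obtain p where p: "p \<in> A a b" "p \<in> A c d" using f(2) g(2) by blast
    have "T a \<inter> A c d = {}" "T b \<inter> A c d = {}" "A a b \<inter> T c = {}" "A a b \<inter> T d = {}"
      using TT V ne T\<gamma>[OF V(1) E(2)] T\<gamma>[OF V(2) E(2)] T\<gamma>[OF V(3) E(1)] T\<gamma>[OF V(4) E(1)]
      unfolding A_def by (simp_all add: Int_Un_distrib Int_Un_distrib2 Int_commute)
    then have "p \<in> path_image (\<gamma> {a, b}) \<inter> path_image (\<gamma> {c, d})"
      using p unfolding A_def by blast
    \<comment> \<open>A vertex on both edges would be a common end, but the four ends are
      distinct.\<close>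
    moreover have "p \<notin> pos ` V"
    proof
      assume "p \<in> pos ` V"
      then obtain v where "v \<in> V" "p = pos v" by blast
      then have "v \<in> {a, b}" "v \<in> {c, d}" using calculation pos_on E by auto
      then show False using ne by auto
    qed
    ultimately show ?thesis by blast
  qed
  have alt: "\<exists>p. (f, p) \<in> crossings V E pos \<gamma> e" if ef: "e \<in> E" "f \<in> E" "alternate pr e f" for e f
  proof -
    obtain a b c d where lt: "pr a < pr c" "pr c < pr b" "pr b < pr d"
      and "e = {a, b} \<and> f = {c, d} \<or> e = {c, d} \<and> f = {a, b}"
      using ef(3) unfolding alternate_def by blast
    moreover have "{a, b} \<noteq> {c, d}" using lt by (auto simp: doubleton_eq_iff)
    ultimately show ?thesis using cross[OF _ _ lt] ef(1,2) unfolding crossings_def by blast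
  qed
  have "circular_1_planar pr V E"
    unfolding circular_1_planar_def
  proof (intro conjI ballI impI \<open>inj_on pr V\<close>, rule ccontr)
    fix e f g assume efg: "e \<in> E" "f \<in> E" "g \<in> E" "alternate pr e f" "alternate pr e g" "f \<noteq> g"
    obtain p q where "(f, p) \<in> crossings V E pos \<gamma> e" "(g, q) \<in> crossings V E pos \<gamma> e"
      using alt efg by meson
    \<comment> \<open>The two pairs differ in the edge, so they count as two crossings even if
      \<open>p = q\<close>.\<close>
    then have "card {(f, p), (g, q)} \<le> card (crossings V E pos \<gamma> e)"
      using cr[OF efg(1)] by (intro card_mono) auto
    then show False using cr[OF efg(1)] efg(6) by simp
  qed
  then show thesis by (rule that)
qed

theorem theorem5p2:
  fixes V :: "'a set" and E :: "'a set set"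
  assumes "simple_graph V E"
    and "outer_1_planar V E"
  shows "proper_conflict_free_choosable TYPE('c) V E 6"
proof -
  obtain pr where "circular_1_planar pr V E"
    using outer_1_planar_imp_circular[OF assms] .
  \<comment> \<open>Initially no edge has been inserted: both edge sets are
    \<open>E\<close>.\<close>
  then show ?thesis
    unfolding proper_conflict_free_choosable_def
    using circular_1_planar_conflict_free[OF assms(1) _ order_refl] by blast
qed

end
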